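(* Let $R$ be a commutative ring with unity, let $m\ge1$ be an integer, let $\lambda_1,\mu_1:\mathbb N\times\mathbb Z\to R$ have triangular support of order $m$, and put $$f_n(x)=\sum_{b=0}^{w_m(n)}\lambda_1(n,b)\,x^{n-mb},\qquad g_n(x)=\sum_{c=0}^{w_m(n)}\mu_1(n,c)\,x^{n-mc}\qquad(n\in\mathbb N).$$ Assume that there exist families $\lambda_3,\mu_3:\mathbb N\times\mathbb Z\to R$ with triangular support of order $m$ such that, for all $n\in\mathbb N$, $$x^n=\sum_{b=0}^{w_m(n)}\lambda_3(n,b)\,f_{n-mb}(x),\qquad x^n=\sum_{c=0}^{w_m(n)}\mu_3(n,c)\,g_{n-mc}(x).$$ Then, for all $n\in\mathbb N$, $$f_n(x)=\sum_{k=0}^{w_m(n)}g_{n-mk}(x)\,z(n,k),\qquad\text{where}\qquad z(n,k)=\sum_{b=0}^{k}\lambda_1(n,b)\,\mu_3(n-mb,k-b).$$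
   Context: $\mathbb N=\{0,1,2,\dots\}$ and $w_m(n)=\lfloor n/m\rfloor$. A family $\lambda:\mathbb N\times\mathbb Z\to R$ has triangular support of order $m$ if $\lambda(n,k)=0$ whenever $k<0$ or $k>w_m(n)$. *)

theory Defs
  imports "HOL-Computational_Algebra.Polynomial"
begin

text \<open>For \<open>m \<ge> 1\<close>, division of natural numbers is the floor of \<open>n / m\<close>.\<close>

definition w :: "nat \<Rightarrow> nat \<Rightarrow> nat"
  where "w m n = n div m"

definition triangular_support :: "nat \<Rightarrow> (nat \<Rightarrow> int \<Rightarrow> 'a::zero) \<Rightarrow> bool"
  where "triangular_support m l \<longleftrightarrow> (\<forall>n k. k < 0 \<or> k > int (w m n) \<longrightarrow> l n k = 0)"

end

theory Submission
  imports Defs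
begin

text \<open>This is a change of basis through the monomials. Each \<open>f n\<close> is a
  combination of the powers x^(n - mb), and the inversion formula for \<open>g\<close> expands each
  power in \<open>g (n - m * b - m * c)\<close>. As floor((n - mb)/m) = floor(n/m) - b, the pairs
  (b, c) fill the triangle b + c \<le> floor(n/m); collecting them by k = b + c gives the
  convolution \<open>z n k\<close>.\<close>

lemma smult_sum_right:
  fixes p :: "'b \<Rightarrow> 'a::comm_semiring_0 poly"
  shows "smult a (\<Sum>i\<in>S. p i) = (\<Sum>i\<in>S. smult a (p i))"
  by (induction S rule: infinite_finite_induct) (auto simp: smult_add_right)

text \<open>The sort admits the zero ring, which \<open>comm_ring_1\<close> would exclude by
  requiring 0 \<noteq> 1.\<close>

theorem corollary2p8:
  fixes m :: nat
    and lambda1 mu1 lambda3 mu3 :: "nat \<Rightarrow> int \<Rightarrow> 'a::{comm_ring,comm_monoid_mult}"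
    and f g :: "nat \<Rightarrow> 'a poly"
    and z :: "nat \<Rightarrow> nat \<Rightarrow> 'a"
  assumes "m \<ge> 1"
    and "triangular_support m lambda1"
    and "triangular_support m mu1"
    and "\<And>n. f n = (\<Sum>b = 0..w m n. monom (lambda1 n (int b)) (n - m * b))"
    and "\<And>n. g n = (\<Sum>c = 0..w m n. monom (mu1 n (int c)) (n - m * c))"
    and "triangular_support m lambda3"
    and "triangular_support m mu3"
    and "\<And>n. monom 1 n = (\<Sum>b = 0..w m n. smult (lambda3 n (int b)) (f (n - m * b)))"
    and "\<And>n. monom 1 n = (\<Sum>c = 0..w m n. smult (mu3 n (int c)) (g (n - m * c)))"
    and "\<And>n k. z n k = (\<Sum>b = 0..k. lambda1 n (int b) * mu3 (n - m * b) (int k - int b))"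
  shows "\<forall>n. f n = (\<Sum>k = 0..w m n. smult (z n k) (g (n - m * k)))"
proof
  fix n
  define W where "W = w m n"
  have W_diff: "w m (n - m * b) = W - b" for b
  proof (cases "m * b \<le> n")
    case True
    then obtain r where "n = m * b + r"
      using le_Suc_ex by blast
    with assms(1) show ?thesis
      by (simp add: W_def w_def)
  next
    \<comment> \<open>Subtraction is truncated: here both \<open>n - m * b\<close> and
      \<open>W - b\<close> are 0, so the identity holds for every \<open>b\<close> and can rewrite
      unconditionally.\<close>
    case False
    then have "n div m < b"
      by (simp add: less_mult_imp_div_less mult.commute)
    with False show ?thesis
      by (simp add: W_def w_def)
  qed
  let ?t = "\<lambda>b c. smult (lambda1 n (int b) * mu3 (n - m * b) (int c)) (g (n - m * (b + c)))"
  have "f n = (\<Sum>b\<le>W. smult (lambda1 n (int b)) (monom 1 (n - m * b)))"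
    by (simp add: assms(4) W_def smult_monom atLeast0AtMost)
  also have "\<dots> = (\<Sum>b\<le>W. \<Sum>c\<le>W - b. ?t b c)"
    by (simp add: assms(9) W_diff smult_sum_right atLeast0AtMost diff_diff_left distrib_left)
  also have "\<dots> = (\<Sum>(b, c)\<in>{(b, c). b + c \<le> W}. ?t b c)"
    by (subst sum.Sigma) (auto intro!: sum.cong)
  \<comment> \<open>Sum along the antidiagonals, with c = k - b.\<close>
  also have "\<dots> = (\<Sum>k\<le>W. \<Sum>b\<le>k. ?t b (k - b))"
    by (rule sum.triangle_reindex_eq)
  \<comment> \<open>Since b \<le> k, b + (k - b) = k, so the \<open>g\<close> factor does not depend
    on b and comes out of the inner sum.\<close>
  also have "\<dots> = (\<Sum>k\<le>W. smult (z n k) (g (n - m * k)))"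
    by (simp add: assms(10) smult_sum atLeast0AtMost of_nat_diff)
  finally show "f n = (\<Sum>k = 0..w m n. smult (z n k) (g (n - m * k)))"
    by (simp add: W_def atLeast0AtMost)
qed

end
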